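(* Let $G$ be a nontrivial finite group and let $N$ be a normal subgroup of $G$. If $N\subseteq \Phi(G)$, then $\iota(G/N)=\iota(G)$.
   Context: All groups are finite. The Frattini subgroup $\Phi(G)$ is the intersection of all maximal subgroups of $G$. For a nontrivial group $G$, the intersection number $\iota(G)$ is the minimum number of maximal subgroups of $G$ whose intersection equals $\Phi(G)$. *)

theory Defs
  imports "HOL-Algebra.Algebra"
begin

definition maximal_subgroup :: "'a set \<Rightarrow> ('a, 'b) monoid_scheme \<Rightarrow> bool" where
  "maximal_subgroup M G \<longleftrightarrow>
     subgroup M G \<and> M \<noteq> carrier G \<and>
     (\<forall>H. subgroup H G \<longrightarrow> M \<subseteq> H \<longrightarrow> H = M \<or> H = carrier G)"

text \<open>Intersections of families of subgroups are taken inside the carrier, so that the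
  intersection of the empty family is the whole group rather than the universal set of
  the element type.\<close>

definition frattini :: "('a, 'b) monoid_scheme \<Rightarrow> 'a set" where
  "frattini G = carrier G \<inter> \<Inter> {M. maximal_subgroup M G}"

text \<open>For a nontrivial finite group the Frattini subgroup is a proper subgroup and the family
  of all maximal subgroups is finite, so the minimum below is attained, and by a nonempty
  family.  In other cases the value carries no meaning.\<close>

definition intersection_number :: "('a, 'b) monoid_scheme \<Rightarrow> nat" where
  "intersection_number G =
     (LEAST n. \<exists>\<M>. \<M> \<subseteq> {M. maximal_subgroup M G} \<and> finite \<M> \<and> card \<M> = n \<and>
        carrier G \<inter> \<Inter> \<M> = frattini G)"

end

theory Submission
  imports Defs
begin

text \<open>Taking unions of cosets is an inclusion-preserving bijection from the subgroups of \<open>G Mod N\<close>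
  onto the subgroups of \<open>G\<close> containing \<open>N\<close>, and it commutes with intersections.  As
  \<open>N \<subseteq> \<Phi>(G)\<close>, every maximal subgroup of \<open>G\<close> contains \<open>N\<close>, so the maximal subgroups of the two
  groups correspond, as do the families of them that intersect in the Frattini subgroup.\<close>

lemma maximal_subgroup_imp_subgroup: "maximal_subgroup M G \<Longrightarrow> subgroup M G"
  by (simp add: maximal_subgroup_def)

context normal
begin

text \<open>Distinct cosets are disjoint, so the only coset that can put \<open>x\<close> into the
  union is its own. Thus \<open>\<Union>A\<close> is the preimage of \<open>A\<close> under the
  projection \<open>x \<mapsto> H #> x\<close>.\<close>

lemma mem_Union_factgroup_subgroup_iff:
  assumes "subgroup A (G Mod H)" and "x \<in> carrier G"
  shows "x \<in> \<Union>A \<longleftrightarrow> H #> x \<in> A"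
  using factgroup_subgroup_union_char[OF assms(1)] assms(2) by blast

lemma carrier_factgroup_subgroupE:
  assumes "subgroup A (G Mod H)" and "U \<in> A"
  obtains x where "x \<in> carrier G" "U = H #> x"
  using subgroup.subset[OF assms(1)] assms(2) by (auto simp: carrier_FactGroup)

text \<open>Passing to the union loses nothing: a coset \<open>H #> x\<close> lies in
  \<open>A\<close> exactly when its representative \<open>x\<close> lies in
  \<open>\<Union>A\<close>. Injectivity of \<open>Union\<close> on subgroups follows.\<close>

lemma factgroup_subgroup_Union_subset_iff:
  assumes A: "subgroup A (G Mod H)" and B: "subgroup B (G Mod H)"
  shows "\<Union>A \<subseteq> \<Union>B \<longleftrightarrow> A \<subseteq> B"
proof
  assume le: "\<Union>A \<subseteq> \<Union>B"
  show "A \<subseteq> B"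
  proof
    fix U assume "U \<in> A"
    then obtain x where "x \<in> carrier G" "U = H #> x"
      using carrier_factgroup_subgroupE[OF A] by blast
    with \<open>U \<in> A\<close> le show "U \<in> B"
      using mem_Union_factgroup_subgroup_iff[OF A, of x] mem_Union_factgroup_subgroup_iff[OF B, of x]
      by (simp add: subset_iff)
  qed
qed blast

lemma factgroup_subgroup_Union_eq_iff:
  assumes "subgroup A (G Mod H)" and "subgroup B (G Mod H)"
  shows "\<Union>A = \<Union>B \<longleftrightarrow> A = B"
  using factgroup_subgroup_Union_subset_iff assms by (metis subset_antisym order_refl)

lemma subset_factgroup_subgroup_Union:
  assumes "subgroup A (G Mod H)"
  shows "H \<subseteq> \<Union>A"
  using subgroup.one_closed[OF assms] by auto

text \<open>Surjectivity of the correspondence. The witness is the image of \<open>K\<close> under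
  the projection.\<close>

lemma subgroup_eq_factgroup_Union:
  assumes K: "subgroup K G" and "H \<subseteq> K"
  obtains A where "subgroup A (G Mod H)" "K = \<Union>A"
proof
  interpret hom: group_hom G "G Mod H" "\<lambda>x. H #> x"
    by (simp add: group_hom_def group_hom_axioms_def r_coset_hom_Mod factorgroup_is_group is_group)
  show "subgroup ((\<lambda>x. H #> x) ` K) (G Mod H)"
    by (rule hom.subgroup_img_is_subgroup[OF K])
  \<comment> \<open>Here \<open>H \<subseteq> K\<close> enters: the union of the cosets of elements
    of \<open>K\<close> does not outgrow \<open>K\<close>.\<close>
  have "H #> x \<subseteq> K" if "x \<in> K" for x
    using that assms subgroup.m_closed[OF K] by (auto simp: r_coset_def)
  moreover have "x \<in> H #> x" if "x \<in> K" for x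
    using that rcos_self[OF _ is_subgroup] subgroup.mem_carrier[OF K] by blast
  ultimately show "K = \<Union>((\<lambda>x. H #> x) ` K)"
    by blast
qed

lemma subgroup_carrier_FactGroup: "subgroup (carrier (G Mod H)) (G Mod H)"
  by (rule group.subgroup_self[OF factorgroup_is_group])

lemma Union_carrier_FactGroup: "\<Union>(carrier (G Mod H)) = carrier G"
  using factgroup_subgroup_union_char[OF subgroup_carrier_FactGroup]
  by (auto simp: carrier_FactGroup)

text \<open>Maximality speaks only of the subgroups lying above, and the correspondence matches
  those above \<open>A\<close> with those above \<open>\<Union>A\<close>, the two whole groups
  included.\<close>

lemma maximal_subgroup_FactGroup_iff:
  assumes A: "subgroup A (G Mod H)"
  shows "maximal_subgroup A (G Mod H) \<longleftrightarrow> maximal_subgroup (\<Union>A) G"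
proof
  assume max: "maximal_subgroup A (G Mod H)"
  have "K = \<Union>A \<or> K = carrier G" if K: "subgroup K G" and le: "\<Union>A \<subseteq> K" for K
  proof -
    \<comment> \<open>Any \<open>K\<close> above \<open>\<Union>A\<close> inherits \<open>H\<close>
      from it, hence comes from a subgroup of the quotient.\<close>
    have "H \<subseteq> K"
      using subset_factgroup_subgroup_Union[OF A] le by blast
    then obtain B where B: "subgroup B (G Mod H)" "K = \<Union>B"
      using subgroup_eq_factgroup_Union[OF K] by blast
    then have "A \<subseteq> B"
      using le factgroup_subgroup_Union_subset_iff[OF A] by blast
    then have "B = A \<or> B = carrier (G Mod H)"
      using max B by (simp add: maximal_subgroup_def)
    then show ?thesis
      using B Union_carrier_FactGroup by auto
  qed
  moreover have "\<Union>A \<noteq> carrier G"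
    using max factgroup_subgroup_Union_eq_iff[OF A subgroup_carrier_FactGroup]
    by (simp add: Union_carrier_FactGroup maximal_subgroup_def)
  ultimately show "maximal_subgroup (\<Union>A) G"
    using factgroup_subgroup_union_subgroup[OF A] by (simp add: maximal_subgroup_def)
next
  assume max: "maximal_subgroup (\<Union>A) G"
  have "B = A \<or> B = carrier (G Mod H)" if B: "subgroup B (G Mod H)" and le: "A \<subseteq> B" for B
  proof -
    have "\<Union>B = \<Union>A \<or> \<Union>B = carrier G"
      using max Union_mono[OF le] factgroup_subgroup_union_subgroup[OF B]
      by (simp add: maximal_subgroup_def)
    then show ?thesis
      using factgroup_subgroup_Union_eq_iff[OF B A]
        factgroup_subgroup_Union_eq_iff[OF B subgroup_carrier_FactGroup]
      by (simp add: Union_carrier_FactGroup)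
  qed
  moreover have "A \<noteq> carrier (G Mod H)"
    using max Union_carrier_FactGroup by (auto simp: maximal_subgroup_def)
  ultimately show "maximal_subgroup A (G Mod H)"
    using A by (simp add: maximal_subgroup_def)
qed

lemma bij_betw_Union_maximal_subgroup_FactGroup:
  assumes "H \<subseteq> frattini G"
  shows "bij_betw Union {A. maximal_subgroup A (G Mod H)} {M. maximal_subgroup M G}"
proof (rule bij_betw_imageI)
  show "inj_on Union {A. maximal_subgroup A (G Mod H)}"
    by (rule inj_onI) (simp add: maximal_subgroup_def factgroup_subgroup_Union_eq_iff)
  have "M \<in> Union ` {A. maximal_subgroup A (G Mod H)}" if M: "maximal_subgroup M G" for M
  proof -
    \<comment> \<open>\<open>frattini G\<close> lies in each maximal subgroup, so the hypothesis on
      \<open>H\<close> lets every \<open>M\<close> be reached.\<close>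
    have "subgroup M G" "H \<subseteq> M"
      using M assms by (auto simp: maximal_subgroup_def frattini_def)
    then obtain A where "subgroup A (G Mod H)" "M = \<Union>A"
      using subgroup_eq_factgroup_Union by blast
    then show ?thesis
      using M maximal_subgroup_FactGroup_iff by blast
  qed
  moreover have "maximal_subgroup (\<Union>A) G" if "maximal_subgroup A (G Mod H)" for A
    using that maximal_subgroup_FactGroup_iff maximal_subgroup_imp_subgroup by blast
  ultimately show "Union ` {A. maximal_subgroup A (G Mod H)} = {M. maximal_subgroup M G}"
    by blast
qed

text \<open>Preimages under the projection commute with intersections. For empty \<open>\<A>\<close>
  both sides are \<open>carrier G\<close>.\<close>

lemma Inter_Union_factgroup_subgroups:
  assumes "\<And>A. A \<in> \<A> \<Longrightarrow> subgroup A (G Mod H)"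
  shows "carrier G \<inter> \<Inter>(Union ` \<A>) = {x \<in> carrier G. H #> x \<in> carrier (G Mod H) \<inter> \<Inter>\<A>}"
proof -
  have "x \<in> \<Union>A \<longleftrightarrow> H #> x \<in> A" if "x \<in> carrier G" "A \<in> \<A>" for x A
    using mem_Union_factgroup_subgroup_iff assms that by blast
  then show ?thesis
    by (auto simp: carrier_FactGroup simp del: Union_iff)
qed

text \<open>The projection maps onto \<open>carrier (G Mod H)\<close>, so subsets of that carrier
  are equal once their preimages are.\<close>

lemma Inter_Union_factgroup_subgroups_eq_iff:
  assumes "\<And>A. A \<in> \<A> \<Longrightarrow> subgroup A (G Mod H)" and "\<And>B. B \<in> \<B> \<Longrightarrow> subgroup B (G Mod H)"
  shows "carrier G \<inter> \<Inter>(Union ` \<A>) = carrier G \<inter> \<Inter>(Union ` \<B>) \<longleftrightarrow>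
    carrier (G Mod H) \<inter> \<Inter>\<A> = carrier (G Mod H) \<inter> \<Inter>\<B>"
  using Inter_Union_factgroup_subgroups[of \<A>, OF assms(1)]
    Inter_Union_factgroup_subgroups[of \<B>, OF assms(2)]
  by (auto simp: carrier_FactGroup set_eq_iff)

text \<open>Both Frattini subgroups are intersections of corresponding families, namely of all
  maximal subgroups, so two intersections are being compared on each side.\<close>

lemma Inter_Union_eq_frattini_iff:
  assumes "H \<subseteq> frattini G" and "\<A> \<subseteq> {A. maximal_subgroup A (G Mod H)}"
  shows "carrier G \<inter> \<Inter>(Union ` \<A>) = frattini G \<longleftrightarrow>
    carrier (G Mod H) \<inter> \<Inter>\<A> = frattini (G Mod H)"
proof -
  have "frattini G = carrier G \<inter> \<Inter>(Union ` {A. maximal_subgroup A (G Mod H)})"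
    using bij_betw_imp_surj_on[OF bij_betw_Union_maximal_subgroup_FactGroup[OF assms(1)]]
    by (simp add: frattini_def)
  moreover have "subgroup A (G Mod H)" if "A \<in> {A. maximal_subgroup A (G Mod H)}" for A
    using that maximal_subgroup_imp_subgroup by blast
  ultimately show ?thesis
    using Inter_Union_factgroup_subgroups_eq_iff[of \<A> "{A. maximal_subgroup A (G Mod H)}"] assms(2)
    by (simp add: frattini_def[of "G Mod H"] subset_iff)
qed

lemma intersection_number_FactGroup:
  assumes "H \<subseteq> frattini G"
  shows "intersection_number (G Mod H) = intersection_number G"
proof -
  let ?Max = "{M. maximal_subgroup M G}" and ?Max' = "{A. maximal_subgroup A (G Mod H)}"
  note bij = bij_betw_Union_maximal_subgroup_FactGroup[OF assms]
  have inj: "inj_on Union \<A>" if "\<A> \<subseteq> ?Max'" for \<A>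
    using bij_betw_imp_inj_on[OF bij] that by (rule inj_on_subset)
  \<comment> \<open>The two \<open>LEAST\<close> predicates agree at every \<open>n\<close>:
    \<open>Union\<close> is injective on maximal subgroups, so families keep their size in both
    directions.\<close>
  have "(\<exists>\<A>\<subseteq>?Max'. finite \<A> \<and> card \<A> = n \<and> carrier (G Mod H) \<inter> \<Inter>\<A> = frattini (G Mod H)) \<longleftrightarrow>
      (\<exists>\<M>\<subseteq>?Max. finite \<M> \<and> card \<M> = n \<and> carrier G \<inter> \<Inter>\<M> = frattini G)" (is "?L \<longleftrightarrow> ?R") for n
  proof
    assume ?L
    then obtain \<A> where *: "\<A> \<subseteq> ?Max'" "finite \<A>" "card \<A> = n"
      "carrier (G Mod H) \<inter> \<Inter>\<A> = frattini (G Mod H)"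
      by blast
    have "Union ` \<A> \<subseteq> ?Max"
      using *(1) bij_betw_imp_surj_on[OF bij] by blast
    moreover have "card (Union ` \<A>) = n"
      using card_image[OF inj[OF *(1)]] *(3) by simp
    ultimately show ?R
      using * Inter_Union_eq_frattini_iff[OF assms *(1)] by blast
  next
    assume ?R
    then obtain \<M> where *: "\<M> \<subseteq> Union ` ?Max'" "finite \<M>" "card \<M> = n"
      "carrier G \<inter> \<Inter>\<M> = frattini G"
      using bij_betw_imp_surj_on[OF bij] by auto
    from *(1) obtain \<A> where \<A>: "\<A> \<subseteq> ?Max'" "\<M> = Union ` \<A>"
      by (rule subset_imageE)
    then show ?L
      using * Inter_Union_eq_frattini_iff[OF assms \<A>(1)]
        card_image[OF inj[OF \<A>(1)]] finite_image_iff[OF inj[OF \<A>(1)]]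
      by auto
  qed
  then show ?thesis
    by (simp add: intersection_number_def)
qed

end

theorem proposition2p3:
  fixes G :: "('a, 'b) monoid_scheme" (structure) and N :: "'a set"
  assumes "group G" and "finite (carrier G)" and "carrier G \<noteq> {\<one>}"
    and "N \<lhd> G" and "N \<subseteq> frattini G"
  shows "intersection_number (G Mod N) = intersection_number G"
  using assms(4,5) by (rule normal.intersection_number_FactGroup)

end
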